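(* Let $Q=(q_{ij})$ be a real symmetric $n\times n$ matrix with zero diagonal, $c\in\mathbb{R}^n$, $R_i=\{j:q_{ij}\neq0\}$, and let $\alpha_{ij}>0$ for $j\in R_i$, $i=1,\dots,n$. Consider the MILP DW($\alpha$) in variables $x_i$ and $y_{ij}$ ($j\in R_i$): maximize $\sum_{i=1}^n\sum_{j\in R_i}q_{ij}y_{ij}+\sum_{i=1}^n c_ix_i$ subject to $\sum_{j\in R_i}\alpha_{ij}(x_j-y_{ij})\le\left(\sum_{j\in R_i}\alpha_{ij}\right)(1-x_i)$ for $i=1,\dots,n$; $2y_{ij}-x_i-x_j\le 0$ for all $j\in R_i$, $i=1,\dots,n$; $x_i\in\{0,1\}$ for all $i$; $y_{ij}\in\{0,1\}$ for all $j\in R_i$, $i=1,\dots,n$. Then DW($\alpha$) is a valid formulation of QUBO.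
   Context: QUBO is the problem: maximize $\sum_{i=1}^n\sum_{j\in R_i}q_{ij}x_ix_j+\sum_{i=1}^n c_ix_i$ over $x\in\{0,1\}^n$. An MILP in variables $(x,y)$ with objective $\sum_i\sum_{j\in R_i}q_{ij}y_{ij}+\sum_i c_ix_i$ is a valid formulation of QUBO if its optimal objective value equals the optimal value of QUBO and the $x$-part of every optimal solution of the MILP is an optimal solution of QUBO. *)

theory Defs
  imports "HOL-Analysis.Analysis"
begin

text \<open>
  Problems are maximization problems, given by an objective function and a feasible set.
  A number is the optimal value only if it is attained by a feasible point.
\<close>

definition optimal_solution :: "('a \<Rightarrow> real) \<Rightarrow> 'a set \<Rightarrow> 'a \<Rightarrow> bool"
  where "optimal_solution f F z \<longleftrightarrow> is_arg_max f (\<lambda>w. w \<in> F) z"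

definition optimal_value :: "('a \<Rightarrow> real) \<Rightarrow> 'a set \<Rightarrow> real \<Rightarrow> bool"
  where "optimal_value f F v \<longleftrightarrow> (\<exists>z. optimal_solution f F z \<and> f z = v)"

definition R :: "real^'n^'n \<Rightarrow> 'n \<Rightarrow> 'n::finite set"
  where "R Q i = {j. Q $ i $ j \<noteq> 0}"

definition binary_vectors :: "(real^'n::finite) set"
  where "binary_vectors = {x. \<forall>i. x $ i \<in> {0, 1}}"

definition qubo_obj :: "real^'n^'n \<Rightarrow> real^'n \<Rightarrow> real^'n::finite \<Rightarrow> real"
  where "qubo_obj Q c x =
    (\<Sum>i\<in>UNIV. \<Sum>j\<in>R Q i. Q $ i $ j * x $ i * x $ j) + (\<Sum>i\<in>UNIV. c $ i * x $ i)"

definition milp_obj ::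
  "real^'n^'n \<Rightarrow> real^'n \<Rightarrow> (real^'n) \<times> ('n::finite \<times> 'n \<Rightarrow> real) \<Rightarrow> real"
  where "milp_obj Q c = (\<lambda>(x, y).
    (\<Sum>i\<in>UNIV. \<Sum>j\<in>R Q i. Q $ i $ j * y (i, j)) + (\<Sum>i\<in>UNIV. c $ i * x $ i))"

definition valid_formulation ::
  "real^'n^'n \<Rightarrow> real^'n \<Rightarrow> ((real^'n) \<times> ('n::finite \<times> 'n \<Rightarrow> real)) set \<Rightarrow> bool"
  where "valid_formulation Q c F \<longleftrightarrow>
    (\<exists>v. optimal_value (milp_obj Q c) F v \<and> optimal_value (qubo_obj Q c) binary_vectors v) \<and>
    (\<forall>x y. optimal_solution (milp_obj Q c) F (x, y) \<longrightarrow>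
           optimal_solution (qubo_obj Q c) binary_vectors x)"

text \<open>
  The variables \<open>y (i, j)\<close> exist only for \<open>j \<in> R Q i\<close>; the extensional function space
  fixes the values outside this index set, so that each feasible point is represented once.
\<close>

definition DW ::
  "real^'n^'n \<Rightarrow> ('n \<times> 'n \<Rightarrow> real) \<Rightarrow> ((real^'n) \<times> ('n::finite \<times> 'n \<Rightarrow> real)) set"
  where "DW Q \<alpha> = {(x, y).
    (\<forall>i. (\<Sum>j\<in>R Q i. \<alpha> (i, j) * (x $ j - y (i, j))) \<le> (\<Sum>j\<in>R Q i. \<alpha> (i, j)) * (1 - x $ i)) \<and>
    (\<forall>i. \<forall>j\<in>R Q i. 2 * y (i, j) - x $ i - x $ j \<le> 0) \<and>
    (\<forall>i. x $ i \<in> {0, 1}) \<and>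
    y \<in> (SIGMA i:UNIV. R Q i) \<rightarrow>\<^sub>E {0, 1}}"

end

theory Submission
  imports Defs
begin

text \<open>
  The linking constraints force \<open>y (i, j) = x i * x j\<close> at every feasible point. If \<open>x i = 0\<close>, then
  \<open>2 * y (i, j) \<le> x j \<le> 1\<close>. If \<open>x i = 1\<close>, then \<open>y (i, j) \<le> x j\<close> makes every summand of the
  aggregated constraint nonnegative while the sum is at most \<open>0\<close>, so all summands vanish. Hence
  the feasible set is the graph of \<open>x \<mapsto> (x i * x j)\<close> over the binary vectors, and the two
  objectives agree along it.
\<close>

text \<open>A binary vector is the indicator of the set of its ones, and an index type in
  \<open>finite\<close> has finitely many subsets.\<close>

lemma finite_binary_vectors: "finite (binary_vectors :: (real^'n::finite) set)"
proof (rule finite_subset)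
  show "binary_vectors \<subseteq> range (\<lambda>A :: 'n set. \<chi> i. if i \<in> A then 1 else (0 :: real))"
  proof
    fix x :: "real^'n"
    assume "x \<in> binary_vectors"
    then have "x = (\<chi> i. if i \<in> {i. x $ i = 1} then 1 else 0)"
      by (auto simp: binary_vectors_def vec_eq_iff)
    then show "x \<in> range (\<lambda>A :: 'n set. \<chi> i. if i \<in> A then 1 else (0 :: real))"
      by (rule range_eqI)
  qed
qed simp

lemma optimal_solution_iff:
  "optimal_solution f F z \<longleftrightarrow> z \<in> F \<and> (\<forall>w\<in>F. f w \<le> f z)"
  by (auto simp: optimal_solution_def is_arg_max_def not_less)

lemma optimal_solution_exists:
  assumes "finite F" "F \<noteq> {}"
  shows "\<exists>z. optimal_solution f F z"
proof -
  have "Max (f ` F) \<in> f ` F"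
    using assms by simp
  then obtain z where "z \<in> F" "f z = Max (f ` F)"
    by auto
  then show ?thesis
    using assms by (auto simp: optimal_solution_iff)
qed

text \<open>On a graph, the projection to \<open>x\<close> is a bijection onto
  \<open>binary_vectors\<close> that preserves the objective, so the maximizers correspond. As
  \<open>optimal_value\<close> demands attainment, a maximizer must also exist; finiteness supplies
  it.\<close>

lemma valid_formulation_graph:
  assumes F: "F = (\<lambda>x. (x, g x)) ` binary_vectors"
    and obj: "\<And>x. milp_obj Q c (x, g x) = qubo_obj Q c x"
  shows "valid_formulation Q c F"
proof -
  have iff: "optimal_solution (milp_obj Q c) F (x, y) \<longleftrightarrow>
      y = g x \<and> optimal_solution (qubo_obj Q c) binary_vectors x" for x y
    by (auto simp: optimal_solution_iff F obj)
  have "0 \<in> (binary_vectors :: (real^'a) set)"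
    by (simp add: binary_vectors_def)
  then obtain x where "optimal_solution (qubo_obj Q c) binary_vectors x"
    using optimal_solution_exists[OF finite_binary_vectors] by blast
  then have "optimal_value (milp_obj Q c) F (qubo_obj Q c x)"
    and "optimal_value (qubo_obj Q c) binary_vectors (qubo_obj Q c x)"
    using iff obj by (auto simp: optimal_value_def)
  then show ?thesis
    using iff by (auto simp: valid_formulation_def)
qed

lemma DW_product:
  assumes \<alpha>: "\<And>i j. j \<in> R Q i \<Longrightarrow> \<alpha> (i, j) > 0"
    and feasible: "(x, y) \<in> DW Q \<alpha>" and j: "j \<in> R Q i"
  shows "y (i, j) = x $ i * x $ j"
proof -
  have sum: "(\<Sum>k\<in>R Q i. \<alpha> (i, k) * (x $ k - y (i, k))) \<le> (\<Sum>k\<in>R Q i. \<alpha> (i, k)) * (1 - x $ i)"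
    using feasible by (simp add: DW_def)
  have link: "2 * y (i, k) \<le> x $ i + x $ k" if "k \<in> R Q i" for k
    using feasible that by (fastforce simp: DW_def)
  have x: "x $ k = 0 \<or> x $ k = 1" for k
    using feasible by (auto simp: DW_def)
  have y: "y (i, k) = 0 \<or> y (i, k) = 1" if "k \<in> R Q i" for k
    using feasible that by (auto simp: DW_def PiE_iff)
  show ?thesis
  proof (cases "x $ i = 0")
    case True
    then show ?thesis
      using link[OF j] x[of j] y[OF j] by auto
  next
    case False
    then have xi: "x $ i = 1"
      using x by blast
    \<comment> \<open>Here \<open>link\<close> reads \<open>2 * y (i, k) \<le> 1 + x $ k\<close>.
      For \<open>x $ k = 0\<close> this only bounds \<open>y (i, k)\<close> by 1/2, and integrality
      brings it down to 0.\<close>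
    have nonneg: "0 \<le> \<alpha> (i, k) * (x $ k - y (i, k))" if "k \<in> R Q i" for k
      using link[OF that] x[of k] y[OF that] \<alpha>[OF that] xi by auto
    have "(\<Sum>k\<in>R Q i. \<alpha> (i, k) * (x $ k - y (i, k))) = 0"
      using sum xi nonneg by (intro antisym sum_nonneg) auto
    then have "\<alpha> (i, j) * (x $ j - y (i, j)) = 0"
      using nonneg j by (simp add: sum_nonneg_eq_0_iff)
    then show ?thesis
      using \<alpha>[OF j] xi by simp
  qed
qed

lemma DW_eq_graph:
  assumes \<alpha>: "\<And>i j. j \<in> R Q i \<Longrightarrow> \<alpha> (i, j) > 0"
  shows "DW Q \<alpha> =
    (\<lambda>x. (x, restrict (\<lambda>(i, j). x $ i * x $ j) (SIGMA i:UNIV. R Q i))) ` binary_vectors"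
    (is "_ = (\<lambda>x. (x, ?g x)) ` _")
proof (rule set_eqI, rule iffI)
  fix z
  assume "z \<in> DW Q \<alpha>"
  moreover obtain x y where z: "z = (x, y)"
    by (cases z)
  ultimately have feasible: "(x, y) \<in> DW Q \<alpha>"
    by simp
  then have "y \<in> extensional (SIGMA i:UNIV. R Q i)" and "x \<in> binary_vectors"
    by (auto simp: DW_def PiE_iff binary_vectors_def)
  \<comment> \<open>Both sides are extensional on the index set, so agreement there is
    enough.\<close>
  moreover have "y = ?g x"
    using calculation(1) DW_product[OF \<alpha> feasible]
    by (intro extensionalityI[of _ "SIGMA i:UNIV. R Q i"]) auto
  ultimately show "z \<in> (\<lambda>x. (x, ?g x)) ` binary_vectors"
    using z by blast
next
  fix z
  assume "z \<in> (\<lambda>x. (x, ?g x)) ` binary_vectors"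
  then obtain x where z: "z = (x, ?g x)" and "x \<in> binary_vectors"
    by blast
  then have x: "x $ i = 0 \<or> x $ i = 1" for i
    by (auto simp: binary_vectors_def)
  \<comment> \<open>Summand by summand:
    \<open>x $ j - x $ i * x $ j = x $ j * (1 - x $ i) \<le> 1 - x $ i\<close>.\<close>
  have "(\<Sum>j\<in>R Q i. \<alpha> (i, j) * (x $ j - ?g x (i, j))) \<le> (\<Sum>j\<in>R Q i. \<alpha> (i, j)) * (1 - x $ i)" for i
    unfolding sum_distrib_right
  proof (rule sum_mono)
    fix j
    assume j: "j \<in> R Q i"
    then show "\<alpha> (i, j) * (x $ j - ?g x (i, j)) \<le> \<alpha> (i, j) * (1 - x $ i)"
      using \<alpha>[OF j] x[of i] x[of j] by auto
  qed
  moreover have "2 * ?g x (i, j) - x $ i - x $ j \<le> 0" if "j \<in> R Q i" for i j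
    using that x[of i] x[of j] by auto
  moreover have "?g x \<in> (SIGMA i:UNIV. R Q i) \<rightarrow>\<^sub>E {0, 1}"
  proof (rule PiE_I)
    fix p
    assume "p \<in> (SIGMA i:UNIV. R Q i)"
    then show "?g x p \<in> {0, 1}"
      using x[of "fst p"] x[of "snd p"] by auto
  qed simp
  ultimately show "z \<in> DW Q \<alpha>"
    using x unfolding z DW_def by blast
qed

theorem theorem2:
  fixes Q :: "real^'n::finite^'n" and c :: "real^'n" and \<alpha> :: "'n \<times> 'n \<Rightarrow> real"
  assumes "transpose Q = Q"
    and "\<And>i. Q $ i $ i = 0"
    and "\<And>i j. j \<in> R Q i \<Longrightarrow> \<alpha> (i, j) > 0"
  shows "valid_formulation Q c (DW Q \<alpha>)"
  using assms(3)
  \<comment> \<open>For the objectives, the sums run only over \<open>j \<in> R Q i\<close>, where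
    \<open>restrict\<close> returns the product itself.\<close>
  by (intro valid_formulation_graph[OF DW_eq_graph])
    (auto simp: milp_obj_def qubo_obj_def mult.assoc intro!: sum.cong)

end
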